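(* Let $N,K\ge 1$ and let $X_1,\ldots,X_K\in\mathbb{C}_{\le N-1}[z]$ be a tuple of polynomials that are not all identically zero. Let $\Gamma_{ij}(z) = X_i(z)\widetilde{X}_j(z)\in\mathbb{C}_{\le 2(N-1)}[z]$ for $i,j\in\{1,\ldots,K\}$. Then the following are equivalent: 1. the factorization problem for $\boldsymbol{\Gamma}=[\Gamma_{ij}]_{i,j=1}^{K,K}$ has an essentially unique solution, i.e., for any $Y_1,\ldots,Y_K\in\mathbb{C}_{\le N-1}[z]$ with $\Gamma_{ij}=Y_i\widetilde{Y}_j$ for all $i,j$, there exists $\beta\in\mathbb{T}$ such that $Y_k=\beta X_k$ for all $k$; 2. $X_1,\ldots,X_K$ have no common roots in $(\mathbb{C}\cup\{\infty\})\setminus\mathbb{T}$; 3. $H(z)=\gcd\{\Gamma_{ij}\}_{i,j=1}^{K,K}$ has no roots in $\mathbb{C}\setminus\mathbb{T}$.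
   Context: $\mathbb{T} = \{z\in\mathbb{C} : |z|=1\}$. $\mathbb{C}_{\le D}[z]$ is the $(D+1)$-dimensional space of complex univariate polynomials of degree at most $D$; a polynomial is always considered together with the space (degree bound) it belongs to. For $A(z)=\sum_{n=0}^{D} a[n]z^n \in \mathbb{C}_{\le D}[z]$, the conjugate reversal is $\widetilde{A}(z) = z^{D}\,\overline{A(\overline{z}^{-1})} = \sum_{n=0}^{D}\overline{a[D-n]}z^n \in \mathbb{C}_{\le D}[z]$. Multiplication is the map $\mathbb{C}_{\le D_1}[z]\times\mathbb{C}_{\le D_2}[z]\to\mathbb{C}_{\le D_1+D_2}[z]$. Roots: $A\in\mathbb{C}_{\le D}[z]\setminus\{0\}$ has a root at $\infty$ of multiplicity $\mu$ if exactly its $\mu$ leading coefficients $a[D],\ldots,a[D-\mu+1]$ vanish; roots are counted in $\mathbb{C}\cup\{\infty\}$, so that a nonzero $A\in\mathbb{C}_{\le D}[z]$ has exactly $D$ roots with multiplicity. The zero polynomial is regarded as having every point of $\mathbb{C}\cup\{\infty\}$ as a root. Divisibility: $C\in\mathbb{C}_{\le M}[z]$ has a divisor $B\in\mathbb{C}_{\le D}[z]\setminus\{0\}$ if there is $A\in\mathbb{C}_{\le M-D}[z]$ with $C=AB$. The $\gcd$ of a set of polynomials (each in its own space) is the polynomial $H\in\mathbb{C}_{\le D}[z]$ with highest possible $D$ that divides all of them in this sense; $\gcd\{A,0\}=A$, and the gcd of zero polynomials is $0\in\mathbb{C}_{\le 0}[z]$. The gcd is defined up to multiplication by a nonzero scalar,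 and equalities involving gcd are meant modulo such a scalar. *)

theory Defs
  imports
    "HOL-Analysis.Analysis"
    "HOL-Computational_Algebra.Computational_Algebra"
    "HOL-Computational_Algebra.Field_as_Ring"
begin

text \<open>
  A polynomial belonging to a space with degree bound \<open>D\<close> is a \<open>complex poly\<close> together with \<open>D\<close>.
  Notions that depend on the space take \<open>D\<close> as an extra argument, or the pair \<open>(D, A)\<close>.
\<close>

definition polys_le :: "nat \<Rightarrow> complex poly set" where
  "polys_le D = {A. degree A \<le> D}"

definition conj_reversal :: "nat \<Rightarrow> complex poly \<Rightarrow> complex poly" where
  "conj_reversal D A = (\<Sum>n\<le>D. monom (cnj (coeff A (D - n))) n)"

lemma coeff_conj_reversal:
  "coeff (conj_reversal D A) n = (if n \<le> D then cnj (coeff A (D - n)) else 0)"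
  by (simp add: conj_reversal_def coeff_sum coeff_monom)

lemma conj_reversal_in_polys_le: "conj_reversal D A \<in> polys_le D"
  by (auto simp: polys_le_def coeff_conj_reversal intro!: degree_le)

text \<open>The closed formula \<open>z^D * cnj (A (1 / cnj z))\<close>, with \<open>inverse (cnj z)\<close> for \<open>1 / cnj z\<close>.\<close>

lemma poly_conj_reversal:
  assumes "A \<in> polys_le D" and "z \<noteq> 0"
  shows "poly (conj_reversal D A) z = z ^ D * cnj (poly A (inverse (cnj z)))"
proof -
  have "poly (conj_reversal D A) z = (\<Sum>n\<le>D. cnj (coeff A (D - n)) * z ^ n)"
    by (simp add: conj_reversal_def poly_sum poly_monom)
  also have "\<dots> = (\<Sum>n\<le>D. cnj (coeff A n) * z ^ (D - n))"
    by (rule sum.reindex_bij_witness[of _ "\<lambda>n. D - n" "\<lambda>n. D - n"]) auto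
  also have "\<dots> = (\<Sum>n\<le>D. z ^ D * (cnj (coeff A n) * inverse z ^ n))"
    using assms(2) by (intro sum.cong) (auto simp: power_diff field_simps)
  also have "\<dots> = z ^ D * cnj (\<Sum>n\<le>D. coeff A n * inverse (cnj z) ^ n)"
    by (simp add: sum_distrib_left)
  also have "(\<Sum>n\<le>D. coeff A n * inverse (cnj z) ^ n) = poly A (inverse (cnj z))"
  proof -
    have "A = (\<Sum>n\<le>D. monom (coeff A n) n)"
      using assms(1) by (simp add: polys_le_def poly_as_sum_of_monoms')
    then have "poly A w = poly (\<Sum>n\<le>D. monom (coeff A n) n) w" for w by (rule arg_cong)
    then show ?thesis by (simp add: poly_sum poly_monom)
  qed
  finally show ?thesis .
qed

datatype point = Finite_point complex | Infinite_point

definition unit_circle :: "point set" where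
  "unit_circle = Finite_point ` sphere 0 1"

text \<open>
  At infinity, the multiplicity is the number of vanishing leading coefficients
  \<open>coeff A D, coeff A (D - 1), \<dots>\<close>, so it is positive exactly when \<open>coeff A D\<close> vanishes. In both
  equations the zero polynomial has the point as a root.
\<close>

fun has_root :: "nat \<Rightarrow> complex poly \<Rightarrow> point \<Rightarrow> bool" where
  "has_root D A (Finite_point z) \<longleftrightarrow> poly A z = 0"
| "has_root D A Infinite_point \<longleftrightarrow> coeff A D = 0"

definition bounded_dvd :: "nat \<times> complex poly \<Rightarrow> nat \<times> complex poly \<Rightarrow> bool" where
  "bounded_dvd = (\<lambda>(D, B) (M, C).
     B \<in> polys_le D \<and> B \<noteq> 0 \<and> D \<le> M \<and> (\<exists>A \<in> polys_le (M - D). C = A * B))"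

definition is_common_divisor ::
    "(nat \<times> complex poly) set \<Rightarrow> nat \<times> complex poly \<Rightarrow> bool" where
  "is_common_divisor S B \<longleftrightarrow> (\<forall>C \<in> S. bounded_dvd B C)"

text \<open>
  Zero members of the set are dropped, so that \<open>gcd {A, 0} = A\<close> holds whatever space \<open>0\<close> is taken
  in. If all members lie in the same space and one of them is nonzero, this makes no difference
  (\<open>is_common_divisor_drop_zero\<close> below).
\<close>

definition is_bounded_gcd ::
    "(nat \<times> complex poly) set \<Rightarrow> nat \<times> complex poly \<Rightarrow> bool" where
  "is_bounded_gcd S H \<longleftrightarrow>
     (let S' = {C \<in> S. snd C \<noteq> 0} in
      if S' = {} then H = (0, 0)
      else is_common_divisor S' H \<and> (\<forall>B. is_common_divisor S' B \<longrightarrow> fst B \<le> fst H))"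

text \<open>
  The choice operator picks one representative of the gcd, which is determined only up to a nonzero
  scalar; see \<open>bounded_gcd_correct\<close> and \<open>is_bounded_gcd_unique\<close>.
\<close>

definition bounded_gcd :: "(nat \<times> complex poly) set \<Rightarrow> nat \<times> complex poly" where
  "bounded_gcd S = (SOME H. is_bounded_gcd S H)"

definition is_factorization ::
    "nat \<Rightarrow> nat \<Rightarrow> (nat \<Rightarrow> nat \<Rightarrow> complex poly) \<Rightarrow> (nat \<Rightarrow> complex poly) \<Rightarrow> bool" where
  "is_factorization N K \<Gamma> Y \<longleftrightarrow>
     (\<forall>k \<in> {1..K}. Y k \<in> polys_le (N - 1)) \<and>
     (\<forall>i \<in> {1..K}. \<forall>j \<in> {1..K}. \<Gamma> i j = Y i * conj_reversal (N - 1) (Y j))"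

definition essentially_unique_factorization ::
    "nat \<Rightarrow> nat \<Rightarrow> (nat \<Rightarrow> nat \<Rightarrow> complex poly) \<Rightarrow> (nat \<Rightarrow> complex poly) \<Rightarrow> bool" where
  "essentially_unique_factorization N K \<Gamma> X \<longleftrightarrow>
     (\<forall>Y. is_factorization N K \<Gamma> Y \<longrightarrow>
        (\<exists>\<beta> \<in> sphere 0 1. \<forall>k \<in> {1..K}. Y k = smult \<beta> (X k)))"

lemma is_common_divisor_drop_zero:
  assumes "\<forall>C \<in> S. fst C = M" and "\<exists>C \<in> S. snd C \<noteq> 0"
  shows "is_common_divisor {C \<in> S. snd C \<noteq> 0} B \<longleftrightarrow> is_common_divisor S B"
proof
  assume L: "is_common_divisor {C \<in> S. snd C \<noteq> 0} B"
  obtain C0 where C0: "C0 \<in> S" "snd C0 \<noteq> 0" using assms(2) by blast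
  have *: "bounded_dvd B C0" using L C0 unfolding is_common_divisor_def by blast
  show "is_common_divisor S B"
    unfolding is_common_divisor_def
  proof
    fix C assume C: "C \<in> S"
    show "bounded_dvd B C"
    proof (cases "snd C = 0")
      case True
      have "fst C = fst C0" using assms(1) C C0 by simp
      with * True show ?thesis
        by (cases B; cases C; cases C0)
           (auto simp: bounded_dvd_def polys_le_def intro!: bexI[of _ 0])
    next
      case False
      with L C show ?thesis unfolding is_common_divisor_def by blast
    qed
  qed
qed (auto simp: is_common_divisor_def)

lemma bounded_gcd_correct:
  assumes "\<And>M C. (M, C) \<in> S \<Longrightarrow> C \<in> polys_le M"
  shows "is_bounded_gcd S (bounded_gcd S)"
proof -
  define S' where "S' = {C \<in> S. snd C \<noteq> 0}"
  have "\<exists>H. is_bounded_gcd S H"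
  proof (cases "S' = {}")
    case True
    then show ?thesis by (auto simp: is_bounded_gcd_def S'_def)
  next
    case False
    then obtain M C where MC: "(M, C) \<in> S'" by auto
    define P where "P D \<longleftrightarrow> (\<exists>B. is_common_divisor S' (D, B))" for D
    have "is_common_divisor S' (0, 1)"
      using assms by (auto simp: is_common_divisor_def bounded_dvd_def S'_def polys_le_def)
    then have "P 0" by (auto simp: P_def)
    moreover have bd: "\<forall>D. P D \<longrightarrow> D \<le> M"
      using MC by (auto simp: P_def is_common_divisor_def bounded_dvd_def)
    ultimately have "P (GREATEST D. P D)" using GreatestI_nat[of P 0 M] by blast
    then obtain H where H: "is_common_divisor S' (GREATEST D. P D, H)"
      by (auto simp: P_def)
    have "P (fst B)" if "is_common_divisor S' B" for B
      unfolding P_def using that by (metis prod.collapse)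
    then have "\<forall>B. is_common_divisor S' B \<longrightarrow> fst B \<le> (GREATEST D. P D)"
      using Greatest_le_nat[of P _ M] bd by blast
    with H False have "is_bounded_gcd S (GREATEST D. P D, H)"
      unfolding is_bounded_gcd_def Let_def S'_def[symmetric] by simp
    then show ?thesis by (rule exI)
  qed
  then show ?thesis unfolding bounded_gcd_def by (rule someI_ex)
qed

lemma bounded_dvd_iff:
  assumes "C \<noteq> 0"
  shows "bounded_dvd (D, B) (M, C) \<longleftrightarrow>
           degree B \<le> D \<and> B dvd C \<and> degree C \<le> M \<and> D - degree B \<le> M - degree C"
proof
  assume "bounded_dvd (D, B) (M, C)"
  then obtain A where "degree B \<le> D" "D \<le> M" "degree A \<le> M - D" "C = A * B"
    by (auto simp: bounded_dvd_def polys_le_def)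
  with assms show "degree B \<le> D \<and> B dvd C \<and> degree C \<le> M \<and> D - degree B \<le> M - degree C"
    by (auto simp: degree_mult_eq)
next
  assume R: "degree B \<le> D \<and> B dvd C \<and> degree C \<le> M \<and> D - degree B \<le> M - degree C"
  then obtain A where A: "C = A * B" by (metis dvdE mult.commute)
  with assms have "degree C = degree A + degree B" "A \<noteq> 0" "B \<noteq> 0"
    by (auto simp: degree_mult_eq)
  with R A show "bounded_dvd (D, B) (M, C)"
    by (auto simp: bounded_dvd_def polys_le_def intro!: bexI[of _ A])
qed

lemma is_bounded_gcd_unique:
  assumes "is_bounded_gcd S (D1, H1)" and "is_bounded_gcd S (D2, H2)"
  shows "D1 = D2 \<and> (\<exists>c. c \<noteq> 0 \<and> H2 = smult c H1)"
proof -
  define S' where "S' = {C \<in> S. snd C \<noteq> 0}"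
  show ?thesis
  proof (cases "S' = {}")
    case True
    with assms show ?thesis by (auto simp: is_bounded_gcd_def S'_def intro: exI[of _ 1])
  next
    case False
    have nz: "C \<noteq> 0" if "(M, C) \<in> S'" for M C using that by (simp add: S'_def)
    define g where "g = Gcd (snd ` S')"
    define v where "v = (LEAST n. \<exists>(M, C) \<in> S'. n = M - degree C)"
    have ex: "\<exists>n. \<exists>(M, C) \<in> S'. n = M - degree C" using False by auto
    obtain M0 C0 where 0: "(M0, C0) \<in> S'" "v = M0 - degree C0"
      using LeastI_ex[OF ex] unfolding v_def by auto
    have v_le: "v \<le> M - degree C" if "(M, C) \<in> S'" for M C
      unfolding v_def by (rule Least_le) (use that in auto)
    have g_dvd: "g dvd C" if "(M, C) \<in> S'" for M C
      unfolding g_def using that by (force intro: Gcd_dvd)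
    have g0: "g \<noteq> 0" using g_dvd[OF 0(1)] nz[OF 0(1)] by auto
    have main: "D = degree g + v \<and> (\<exists>c. c \<noteq> 0 \<and> g = smult c H)"
      if "is_bounded_gcd S (D, H)" for D H
    proof -
      have cd: "is_common_divisor S' (D, H)"
        and mx: "\<And>E B. is_common_divisor S' (E, B) \<Longrightarrow> E \<le> D"
        using that False unfolding is_bounded_gcd_def Let_def S'_def[symmetric] by auto
      have dv: "degree H \<le> D \<and> H dvd C \<and> degree C \<le> M \<and> D - degree H \<le> M - degree C"
        if "(M, C) \<in> S'" for M C
        using cd that bounded_dvd_iff[OF nz[OF that]] by (auto simp: is_common_divisor_def)
      have "is_common_divisor S' (degree g + v, g)"
        unfolding is_common_divisor_def
        using dv g_dvd v_le nz by (auto simp: bounded_dvd_iff)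
      then have 1: "degree g + v \<le> D" by (rule mx)
      have Hg: "H dvd g" unfolding g_def by (rule Gcd_greatest) (use dv in auto)
      then obtain A where A: "g = H * A" by (rule dvdE)
      with g0 have "H \<noteq> 0" "A \<noteq> 0" by auto
      then have deg: "degree g = degree H + degree A" using A by (simp add: degree_mult_eq)
      have 2: "D - degree H \<le> v" "degree H \<le> D" using dv[OF 0(1)] 0(2) by auto
      from 1 2 deg have "degree A = 0" "D = degree g + v" by auto
      then obtain c where "A = [:c:]" by (auto elim: degree_eq_zeroE)
      with A \<open>A \<noteq> 0\<close> \<open>D = degree g + v\<close> show ?thesis by (auto intro!: exI[of _ c])
    qed
    obtain c1 c2 where "c1 \<noteq> 0" "c2 \<noteq> 0" "g = smult c1 H1" "g = smult c2 H2"
      using main[OF assms(1)] main[OF assms(2)] by auto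
    then have "smult (inverse c2) (smult c1 H1) = smult (inverse c2) (smult c2 H2)" by simp
    with \<open>c2 \<noteq> 0\<close> have "H2 = smult (inverse c2 * c1) H1" by simp
    with main[OF assms(1)] main[OF assms(2)] \<open>c1 \<noteq> 0\<close> \<open>c2 \<noteq> 0\<close> show ?thesis
      by (intro conjI exI[of _ "inverse c2 * c1"]) auto
  qed
qed

end

theory Submission
  imports Defs
begin

text \<open>
  Write \<open>n = N - 1\<close>, \<open>R\<close> for the conjugate reversal on polynomials of degree at most \<open>n\<close>, and
  \<open>\<sigma> p = 1 / cnj p\<close> for the reflection of \<open>\<complex> \<union> {\<infinity>}\<close> in the unit circle. Reversal is multiplicative and
  involutive and transports roots along \<open>\<sigma>\<close>, whose fixed points are the points of the circle.

  \<^bold>\<open>Non-uniqueness.\<close> A common root off the circle is a common factor \<open>B\<close> of the \<open>X k\<close> of degree bound 1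
  (for the root \<open>\<infinity>\<close> the factor is the constant 1). Replacing \<open>B\<close> by its reversal in every \<open>X k\<close>
  moves this root to its mirror image, which is a different point, and leaves all products
  \<open>X i * R (X j)\<close> unchanged, since \<open>B\<close> and its reversal merely trade places
  (\<open>common_root_imp_other_factorization\<close>).

  \<^bold>\<open>Uniqueness.\<close> If \<open>Y\<close> has the same products as \<open>X\<close>, then \<open>X i * Y k = X k * Y i\<close>, so \<open>X\<close> and \<open>Y\<close> are
  proportional over the rational functions. The factor of proportionality has to be a constant. On the circle
  reversal preserves the order of vanishing, so \<open>X k * R (X k) = Y k * R (Y k)\<close> makes \<open>X k\<close> and
  \<open>Y k\<close> vanish to the same order. At any other point, \<open>\<infinity>\<close> included, some \<open>X j\<close> does not vanish, and
  \<open>X j * Y k = X k * Y j\<close> shows that \<open>Y k\<close> vanishes to at least the order of \<open>X k\<close>. Hence \<open>X k\<close> divides \<open>Y k\<close>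
  and, as the order comparison at \<open>\<infinity>\<close> says that \<open>Y k\<close> has no larger degree, the quotient is constant; it is
  unimodular because the products agree (\<open>equal_products_imp_unimodular_multiple\<close>).

  \<^bold>\<open>The gcd.\<close> The finite roots of \<open>H\<close> are the common finite roots of the \<open>\<Gamma> i j\<close>
  (\<open>bounded_gcd_root_iff\<close>). A point \<open>z\<close> is a root of all products \<open>X i * R (X j)\<close> iff it is a common
  root of the \<open>X i\<close> or a common root of the \<open>R (X j)\<close>, and the latter means that \<open>\<sigma> z\<close> is a common
  root of the \<open>X j\<close>. In particular a common root at \<open>\<infinity>\<close> is seen by \<open>H\<close> at the finite point \<open>0\<close>, which
  is why only finite roots of \<open>H\<close> have to be examined.
\<close>

section \<open>Algebra of conjugate reversal\<close>

lemma poly_eqI_nonzero: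
  fixes p q :: "complex poly"
  assumes "\<And>z. z \<noteq> 0 \<Longrightarrow> poly p z = poly q z"
  shows "p = q"
proof -
  \<comment> \<open>Multiplication by \<open>x\<close> forces agreement at \<open>0\<close> as well.\<close>
  have "poly ([:0, 1:] * p) z = poly ([:0, 1:] * q) z" for z
    using assms[of z] by (cases "z = 0") auto
  then have "[:0, 1:] * p = [:0, 1:] * q" by (simp only: poly_eq_poly_eq_iff[symmetric] fun_eq_iff) simp
  then show ?thesis by simp
qed

lemma conj_reversal_mult:
  assumes "A \<in> polys_le D" and "B \<in> polys_le E"
  shows "conj_reversal (D + E) (A * B) = conj_reversal D A * conj_reversal E B"
proof (rule poly_eqI_nonzero)
  fix z :: complex assume "z \<noteq> 0"
  moreover have "A * B \<in> polys_le (D + E)"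
    using assms degree_mult_le[of A B] by (auto simp: polys_le_def)
  ultimately show "poly (conj_reversal (D + E) (A * B)) z = poly (conj_reversal D A * conj_reversal E B) z"
    using assms by (simp add: poly_conj_reversal power_add)
qed

lemma conj_reversal_conj_reversal:
  assumes "A \<in> polys_le D"
  shows "conj_reversal D (conj_reversal D A) = A"
  using assms by (intro poly_eqI) (auto simp: coeff_conj_reversal polys_le_def coeff_eq_0)

lemma conj_reversal_eq_0_iff:
  assumes "A \<in> polys_le D"
  shows "conj_reversal D A = 0 \<longleftrightarrow> A = 0"
proof -
  have "conj_reversal D 0 = 0" by (simp add: conj_reversal_def)
  then show ?thesis using conj_reversal_conj_reversal[OF assms] by auto
qed

lemma conj_reversal_smult: "conj_reversal D (smult c A) = smult (cnj c) (conj_reversal D A)"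
  by (rule poly_eqI) (simp add: coeff_conj_reversal)

lemma conj_reversal_linear: "conj_reversal (Suc 0) [:a, b:] = [:cnj b, cnj a:]"
  by (rule poly_eqI) (auto simp: coeff_conj_reversal coeff_pCons split: nat.splits)

section \<open>Reflection of roots in the unit circle\<close>

fun reflect_point :: "point \<Rightarrow> point" where
  "reflect_point (Finite_point z) = (if z = 0 then Infinite_point else Finite_point (inverse (cnj z)))"
| "reflect_point Infinite_point = Finite_point 0"

lemma has_root_conj_reversal_iff:
  assumes "A \<in> polys_le D"
  shows "has_root D (conj_reversal D A) p \<longleftrightarrow> has_root D A (reflect_point p)"
proof (cases p)
  case (Finite_point z)
  then show ?thesis
    using assms by (auto simp: poly_conj_reversal poly_0_coeff_0 coeff_conj_reversal)
qed (simp add: poly_0_coeff_0 coeff_conj_reversal)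

lemma reflect_point_in_unit_circle_iff: "reflect_point p \<in> unit_circle \<longleftrightarrow> p \<in> unit_circle"
  by (cases p) (auto simp: unit_circle_def norm_inverse)

text \<open>
  For \<open>w\<close> on the circle, the reversal of \<open>x - w\<close> is \<open>1 - cnj w * x\<close>, which is \<open>x - w\<close> up to a scalar.
\<close>

lemma linear_power_dvd_conj_reversal:
  assumes "norm w = 1" and "A \<in> polys_le D" and "[:- w, 1:] ^ m dvd A"
  shows "[:- w, 1:] ^ m dvd conj_reversal D A"
  using assms(2,3)
proof (induction m arbitrary: A D)
  case (Suc m)
  show ?case
  proof (cases "A = 0")
    case True
    then show ?thesis by (simp add: conj_reversal_def)
  next
    case False
    from Suc.prems(2) obtain Q where Q: "A = [:- w, 1:] * ([:- w, 1:] ^ m * Q)"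
      unfolding power_Suc mult.assoc[symmetric] by (rule dvdE)
    define A' where "A' = [:- w, 1:] ^ m * Q"
    have A: "A = [:- w, 1:] * A'" using Q by (simp add: A'_def)
    with False have "degree A = 1 + degree A'" by (subst A, subst degree_mult_eq) auto
    with Suc.prems(1) obtain E where E: "D = 1 + E" "A' \<in> polys_le E"
      by (auto simp: polys_le_def nat_le_iff_add)
    have "w * cnj w = 1" using assms(1) by (metis complex_norm_square of_real_1 power_one)
    then have "[:1, - cnj w:] = smult (- cnj w) [:- w, 1:]" by (simp add: mult.commute)
    then have "conj_reversal 1 [:- w, 1:] = smult (- cnj w) [:- w, 1:]"
      by (simp add: conj_reversal_linear)
    moreover have "[:- w, 1:] \<in> polys_le 1" by (simp add: polys_le_def)
    ultimately have "conj_reversal D A = smult (- cnj w) ([:- w, 1:] * conj_reversal E A')"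
      unfolding A E(1) by (simp only: conj_reversal_mult E(2) mult_smult_left)
    moreover have "[:- w, 1:] ^ m dvd conj_reversal E A'"
      by (rule Suc.IH) (use E A'_def in auto)
    ultimately show ?thesis by (simp only: power_Suc dvd_smult mult_dvd_mono dvd_refl)
  qed
qed simp

lemma order_conj_reversal:
  assumes "norm w = 1" and "A \<in> polys_le D" and "A \<noteq> 0"
  shows "order w (conj_reversal D A) = order w A"
proof -
  have le: "order w B \<le> order w (conj_reversal D B)" if "B \<in> polys_le D" "B \<noteq> 0" for B
    using linear_power_dvd_conj_reversal[OF assms(1) that(1) order_1[of w B]] that
    by (simp add: order_divides conj_reversal_eq_0_iff)
  show ?thesis
    using le[OF assms(2,3)] le[OF conj_reversal_in_polys_le[of D A]] assms
    by (simp add: conj_reversal_conj_reversal conj_reversal_eq_0_iff)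
qed

section \<open>Moving a common root off the circle\<close>

text \<open>
  In the linear factor \<open>B\<close> both kinds of root become uniform: \<open>B = x - z\<close> for a finite root \<open>z\<close> and
  \<open>B = 1\<close>, taken with degree bound 1, for a root at \<open>\<infinity>\<close>. The reversal of \<open>B\<close> is \<open>1 - cnj z * x\<close> or
  \<open>x\<close>; that it is no unimodular multiple of \<open>B\<close> is where the root being off the circle enters.
\<close>

lemma common_root_imp_common_linear_factor:
  assumes "p \<notin> unit_circle"
  obtains B where "B \<in> polys_le 1" and "\<And>\<beta>. \<beta> \<in> sphere 0 1 \<Longrightarrow> conj_reversal 1 B \<noteq> smult \<beta> B"
    and "\<And>A n. A \<in> polys_le n \<Longrightarrow> A \<noteq> 0 \<Longrightarrow> has_root n A p \<Longrightarrow>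
           \<exists>Q \<in> polys_le (n - 1). n \<ge> 1 \<and> A = B * Q"
proof (cases p)
  case (Finite_point z)
  show thesis
  proof (rule that[of "[:- z, 1:]"])
    show "[:- z, 1:] \<in> polys_le 1" by (simp add: polys_le_def)
    show "conj_reversal 1 [:- z, 1:] \<noteq> smult \<beta> [:- z, 1:]" if "\<beta> \<in> sphere 0 1" for \<beta>
    proof
      assume "conj_reversal 1 [:- z, 1:] = smult \<beta> [:- z, 1:]"
      then have "- cnj z = \<beta>" by (simp add: conj_reversal_linear)
      with that have "norm z = 1" by auto
      with assms Finite_point show False by (auto simp: unit_circle_def)
    qed
    fix A n assume A: "A \<in> polys_le n" "A \<noteq> 0" "has_root n A p"
    then obtain Q where Q: "A = [:- z, 1:] * Q"
      using Finite_point by (auto simp: poly_eq_0_iff_dvd)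
    with A(2) have "degree A = 1 + degree Q" by (subst Q, subst degree_mult_eq) auto
    with A(1) have "Q \<in> polys_le (n - 1)" "n \<ge> 1" by (auto simp: polys_le_def)
    with Q show "\<exists>Q \<in> polys_le (n - 1). n \<ge> 1 \<and> A = [:- z, 1:] * Q" by blast
  qed
next
  case Infinite_point
  show thesis
  proof (rule that[of "[:1, 0:]"])
    show "conj_reversal 1 [:1, 0:] \<noteq> smult \<beta> [:1, 0:]" for \<beta>
      using conj_reversal_linear[of 1 0] by simp
    fix A n assume A: "A \<in> polys_le n" "A \<noteq> 0" "has_root n A p"
    then have "degree A \<noteq> n" using Infinite_point by auto
    with A(1) have "degree A \<le> n - 1" "n \<ge> 1" by (auto simp: polys_le_def)
    then show "\<exists>Q \<in> polys_le (n - 1). n \<ge> 1 \<and> A = [:1, 0:] * Q"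
      by (auto simp: polys_le_def)
  qed (simp add: polys_le_def)
qed

lemma common_root_imp_other_factorization:
  assumes X: "\<And>k. k \<in> I \<Longrightarrow> X k \<in> polys_le n" and nz: "\<exists>k \<in> I. X k \<noteq> 0"
    and p: "p \<notin> unit_circle" "\<And>k. k \<in> I \<Longrightarrow> has_root n (X k) p"
  obtains Y where "\<And>k. k \<in> I \<Longrightarrow> Y k \<in> polys_le n"
    and "\<And>i j. i \<in> I \<Longrightarrow> j \<in> I \<Longrightarrow> Y i * conj_reversal n (Y j) = X i * conj_reversal n (X j)"
    and "\<not> (\<exists>\<beta> \<in> sphere 0 1. \<forall>k \<in> I. Y k = smult \<beta> (X k))"
proof -
  obtain B where B: "B \<in> polys_le 1"
    and B_ne: "\<And>\<beta>. \<beta> \<in> sphere 0 1 \<Longrightarrow> conj_reversal 1 B \<noteq> smult \<beta> B"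
    and B_dvd: "\<And>A m. A \<in> polys_le m \<Longrightarrow> A \<noteq> 0 \<Longrightarrow> has_root m A p \<Longrightarrow>
          \<exists>Q \<in> polys_le (m - 1). m \<ge> 1 \<and> A = B * Q"
    using common_root_imp_common_linear_factor[OF p(1)] by metis
  obtain k0 where k0: "k0 \<in> I" "X k0 \<noteq> 0" using nz by blast
  \<comment> \<open>A nonzero polynomial with degree bound 0 has no root, so the truncated \<open>n - 1\<close> is harmless.\<close>
  have n: "n = 1 + (n - 1)" using B_dvd[OF X[OF k0(1)] k0(2) p(2)[OF k0(1)]] by auto
  have "\<exists>Q. Q \<in> polys_le (n - 1) \<and> X k = B * Q" if "k \<in> I" for k
    using B_dvd[OF X[OF that] _ p(2)[OF that]]
    by (cases "X k = 0") (auto simp: polys_le_def intro: exI[of _ 0])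
  then obtain Q where Q: "\<And>k. k \<in> I \<Longrightarrow> Q k \<in> polys_le (n - 1)" "\<And>k. k \<in> I \<Longrightarrow> X k = B * Q k"
    by metis
  define B' where "B' = conj_reversal 1 B"
  have B': "B' \<in> polys_le 1" unfolding B'_def by (rule conj_reversal_in_polys_le)
  have rev: "conj_reversal n (C * Q k) = conj_reversal 1 C * conj_reversal (n - 1) (Q k)"
    if "C \<in> polys_le 1" "k \<in> I" for C k
    using conj_reversal_mult[OF that(1) Q(1)[OF that(2)]] n by simp
  show thesis
  proof (rule that[of "\<lambda>k. B' * Q k"])
    show "B' * Q k \<in> polys_le n" if "k \<in> I" for k
      using degree_mult_le[of B' "Q k"] B' Q(1)[OF that] n by (simp add: polys_le_def)
    show "B' * Q i * conj_reversal n (B' * Q j) = X i * conj_reversal n (X j)"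
      if "i \<in> I" "j \<in> I" for i j
    proof -
      have "conj_reversal 1 B' = B" unfolding B'_def by (rule conj_reversal_conj_reversal[OF B])
      then have "conj_reversal n (B' * Q j) = B * conj_reversal (n - 1) (Q j)"
        by (simp only: rev[OF B' that(2)])
      moreover have "conj_reversal n (B * Q j) = B' * conj_reversal (n - 1) (Q j)"
        by (simp only: rev[OF B that(2)] B'_def)
      ultimately show ?thesis by (simp add: Q(2) that)
    qed
    show "\<not> (\<exists>\<beta> \<in> sphere 0 1. \<forall>k \<in> I. B' * Q k = smult \<beta> (X k))"
    proof
      assume "\<exists>\<beta> \<in> sphere 0 1. \<forall>k \<in> I. B' * Q k = smult \<beta> (X k)"
      then obtain \<beta> where \<beta>: "\<beta> \<in> sphere 0 1" "B' * Q k0 = smult \<beta> (X k0)" using k0 by blast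
      then have "B' * Q k0 = smult \<beta> B * Q k0" using Q(2)[OF k0(1)] by simp
      then have "B' = smult \<beta> B" using k0 Q(2)[OF k0(1)] by (auto simp del: mult_smult_left)
      with B_ne[OF \<beta>(1)] show False by (simp add: B'_def)
    qed
  qed
qed

section \<open>Uniqueness without common roots off the circle\<close>

lemma complex_poly_dvd_if_order_le:
  fixes p q :: "complex poly"
  assumes "p \<noteq> 0" and "q \<noteq> 0" and "\<And>w. order w p \<le> order w q"
  shows "p dvd q"
  using assms
proof (induction "degree p" arbitrary: p q)
  case 0
  then show ?case by (simp add: is_unit_iff_degree unit_imp_dvd)
next
  case (Suc d)
  then have "\<not> constant (poly p)" by (simp add: constant_degree)
  then obtain z where z: "poly p z = 0" using fundamental_theorem_of_algebra by blast
  then have "order z p \<noteq> 0" using Suc.prems(1) order_root by blast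
  then have "order z q \<noteq> 0" using Suc.prems(3)[of z] by simp
  then have "poly q z = 0" using order_root by blast
  with z obtain p' q' where pq: "p = [:- z, 1:] * p'" "q = [:- z, 1:] * q'"
    by (auto simp: poly_eq_0_iff_dvd elim!: dvdE)
  with Suc.prems have nz: "p' \<noteq> 0" "q' \<noteq> 0" by auto
  have "degree p = 1 + degree p'" using nz by (subst pq, subst degree_mult_eq) auto
  moreover have "order w p' \<le> order w q'" for w
    using Suc.prems(3)[of w] Suc.prems(1,2) unfolding pq by (simp add: order_mult del: mult_pCons_left)
  ultimately have "p' dvd q'" using Suc.hyps nz by auto
  then show ?case unfolding pq by (rule mult_dvd_mono[OF dvd_refl])
qed

lemma equal_products_imp_unimodular_multiple:
  assumes X: "\<And>k. k \<in> I \<Longrightarrow> X k \<in> polys_le n" and Y: "\<And>k. k \<in> I \<Longrightarrow> Y k \<in> polys_le n"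
    and nz: "\<exists>k \<in> I. X k \<noteq> 0"
    and eq: "\<And>i j. i \<in> I \<Longrightarrow> j \<in> I \<Longrightarrow> Y i * conj_reversal n (Y j) = X i * conj_reversal n (X j)"
    and no_root: "\<And>p. p \<notin> unit_circle \<Longrightarrow> \<exists>k \<in> I. \<not> has_root n (X k) p"
  shows "\<exists>\<beta> \<in> sphere 0 1. \<forall>k \<in> I. Y k = smult \<beta> (X k)"
proof -
  have zero_iff: "Y k = 0 \<longleftrightarrow> X k = 0" if "k \<in> I" for k
    using eq[OF that that] conj_reversal_eq_0_iff[OF X[OF that]] conj_reversal_eq_0_iff[OF Y[OF that]]
    by auto
  obtain k0 where k0: "k0 \<in> I" "X k0 \<noteq> 0" using nz by blast
  have Y0: "Y k0 \<noteq> 0" using k0 zero_iff by blast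
  have cross: "X j * Y k = X k * Y j" if "j \<in> I" "k \<in> I" for j k
  proof -
    \<comment> \<open>Multiplied by this nonzero polynomial, both sides become products of entries shared by \<open>X\<close> and \<open>Y\<close>.\<close>
    let ?r = "conj_reversal n (X k0) * conj_reversal n (Y k0)"
    have "X j * Y k * ?r = (X j * conj_reversal n (X k0)) * (Y k * conj_reversal n (Y k0))"
      by (simp add: algebra_simps)
    also have "\<dots> = (Y j * conj_reversal n (Y k0)) * (X k * conj_reversal n (X k0))"
      using eq that k0(1) by simp
    also have "\<dots> = X k * Y j * ?r" by (simp add: algebra_simps)
    finally show ?thesis
      using k0 Y0 X Y by (simp add: conj_reversal_eq_0_iff)
  qed
  have order_circle: "order w (Y k0) = order w (X k0)" if "norm w = 1" for w
  proof -
    have XR: "conj_reversal n (X k0) \<noteq> 0" "conj_reversal n (Y k0) \<noteq> 0"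
      using k0 Y0 X Y by (auto simp: conj_reversal_eq_0_iff)
    have "order w (Y k0) + order w (conj_reversal n (Y k0)) =
          order w (X k0) + order w (conj_reversal n (X k0))"
      using arg_cong[OF eq[OF k0(1) k0(1)], of "order w"] XR k0(2) Y0 by (simp add: order_mult)
    then show ?thesis
      using order_conj_reversal[OF that X[OF k0(1)] k0(2)] order_conj_reversal[OF that Y[OF k0(1)] Y0]
      by simp
  qed
  have "order w (X k0) \<le> order w (Y k0)" for w
  proof (cases "norm w = 1")
    case False
    then have "Finite_point w \<notin> unit_circle" by (auto simp: unit_circle_def)
    with no_root obtain j where j: "j \<in> I" "poly (X j) w \<noteq> 0" by fastforce
    then have "X j \<noteq> 0" "Y j \<noteq> 0" "order w (X j) = 0"
      using zero_iff by (auto intro: order_0I)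
    then show ?thesis
      using arg_cong[OF cross[OF j(1) k0(1)], of "order w"] k0(2) Y0 by (simp add: order_mult)
  qed (simp add: order_circle)
  then have "X k0 dvd Y k0" by (rule complex_poly_dvd_if_order_le[OF k0(2) Y0])
  then obtain C where C: "Y k0 = X k0 * C" by (rule dvdE)
  \<comment> \<open>The point at infinity: some \<open>X j\<close> has full degree \<open>n\<close>, so \<open>Y k0\<close> cannot gain degree over \<open>X k0\<close>.\<close>
  have "degree (Y k0) \<le> degree (X k0)"
  proof -
    have "Infinite_point \<notin> unit_circle" by (auto simp: unit_circle_def)
    with no_root obtain j where j: "j \<in> I" "coeff (X j) n \<noteq> 0" by fastforce
    then have "X j \<noteq> 0" "degree (X j) = n"
      using X[OF j(1)] le_degree[of "X j" n] by (auto simp: polys_le_def)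
    moreover from this have "Y j \<noteq> 0" using zero_iff j by blast
    moreover have "degree (Y j) \<le> n" using Y[OF j(1)] by (simp add: polys_le_def)
    ultimately show ?thesis
      using arg_cong[OF cross[OF j(1) k0(1)], of degree] k0(2) Y0 by (simp add: degree_mult_eq)
  qed
  with C k0(2) Y0 have "degree C = 0" by (auto simp: degree_mult_eq)
  then obtain \<beta> where "C = [:\<beta>:]" by (auto elim: degree_eq_zeroE)
  with C have \<beta>: "Y k0 = smult \<beta> (X k0)" by simp
  have all: "Y k = smult \<beta> (X k)" if "k \<in> I" for k
  proof -
    have "X k0 * Y k = X k0 * smult \<beta> (X k)"
      using cross[OF k0(1) that] \<beta> by (simp add: mult.commute)
    then show ?thesis using k0(2) by (metis mult_left_cancel)
  qed
  have "\<beta> * cnj \<beta> = 1"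
  proof -
    \<comment> \<open>The \<open>k0\<close>-th diagonal product is nonzero and gets multiplied by \<open>\<beta> * cnj \<beta>\<close>.\<close>
    let ?P = "X k0 * conj_reversal n (X k0)"
    have "?P \<noteq> 0" using k0 X by (simp add: conj_reversal_eq_0_iff)
    moreover have "smult (\<beta> * cnj \<beta>) ?P = smult 1 ?P"
      using eq[OF k0(1) k0(1)] unfolding \<beta> conj_reversal_smult by (simp add: mult.commute)
    ultimately show ?thesis by (metis leading_coeff_0_iff lead_coeff_smult mult_right_cancel)
  qed
  then have "(norm \<beta>)\<^sup>2 = 1"
    by (metis complex_norm_square of_real_eq_1_iff of_real_power)
  then have "\<beta> \<in> sphere 0 1" by (simp add: power2_eq_1_iff) (smt (verit) norm_ge_zero)
  with all show ?thesis by blast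
qed

section \<open>Finite roots of the gcd\<close>

text \<open>
  If \<open>z\<close> were a root of all members but not of \<open>H\<close>, then \<open>x - z\<close> would be coprime to \<open>H\<close>, and
  \<open>H * (x - z)\<close> would be a common divisor with larger degree bound: the deficit \<open>D - degree H\<close>, which
  is the multiplicity at \<open>\<infinity>\<close>, stays the same.
\<close>

lemma bounded_gcd_root_iff:
  assumes gcd: "is_bounded_gcd S (D, H)" and nz: "\<exists>C \<in> S. snd C \<noteq> 0"
  shows "poly H z = 0 \<longleftrightarrow> (\<forall>C \<in> S. poly (snd C) z = 0)"
proof
  define S' where "S' = {C \<in> S. snd C \<noteq> 0}"
  have "S' \<noteq> {}" using nz by (auto simp only: S'_def)
  then have cd: "is_common_divisor S' (D, H)"
    and mx: "\<And>E B. is_common_divisor S' (E, B) \<Longrightarrow> E \<le> D"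
    using gcd unfolding is_bounded_gcd_def Let_def S'_def[symmetric] by auto
  have dv: "degree H \<le> D \<and> H dvd C \<and> degree C \<le> M \<and> D - degree H \<le> M - degree C" "C \<noteq> 0"
    if "(M, C) \<in> S'" for M C
    using cd that bounded_dvd_iff[of C D H M] by (auto simp: is_common_divisor_def S'_def)
  show "\<forall>C \<in> S. poly (snd C) z = 0" if "poly H z = 0"
  proof
    fix C assume "C \<in> S"
    with dv(1)[of "fst C" "snd C"] have "snd C = 0 \<or> H dvd snd C" by (auto simp: S'_def)
    with that show "poly (snd C) z = 0" by (auto elim!: dvdE)
  qed
  show "poly H z = 0" if root: "\<forall>C \<in> S. poly (snd C) z = 0"
  proof (rule ccontr)
    assume Hz: "poly H z \<noteq> 0"
    then have "H \<noteq> 0" by auto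
    have "is_common_divisor S' (D + 1, [:- z, 1:] * H)"
      unfolding is_common_divisor_def
    proof
      fix MC assume MC: "MC \<in> S'"
      obtain M C where [simp]: "MC = (M, C)" by (cases MC)
      note d = dv[of M C, OF MC[simplified]]
      from d obtain A where A: "C = H * A" by (auto elim: dvdE)
      have "poly C z = 0" using root MC by (force simp: S'_def)
      with A Hz have "[:- z, 1:] dvd A" by (simp add: poly_eq_0_iff_dvd[symmetric])
      then have "[:- z, 1:] * H dvd C" unfolding A by (subst mult.commute) (rule mult_dvd_mono[OF dvd_refl])
      moreover have "degree ([:- z, 1:] * H) = degree H + 1"
        using \<open>H \<noteq> 0\<close> by (subst degree_mult_eq) auto
      ultimately show "bounded_dvd (D + 1, [:- z, 1:] * H) MC"
        using d by (simp add: bounded_dvd_iff del: mult_pCons_left)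
    qed
    then show False using mx by fastforce
  qed
qed

text \<open>
  The product over \<open>i\<close> and \<open>j\<close> separates: if neither all \<open>X i\<close> nor all reversals vanish at \<open>z\<close>, then
  some product does not vanish at \<open>z\<close>. Reversal turns the second alternative into a common root at the
  mirror image of \<open>z\<close>.
\<close>

lemma products_common_root_iff:
  assumes X: "\<And>k. k \<in> I \<Longrightarrow> X k \<in> polys_le n"
  shows "(\<forall>i \<in> I. \<forall>j \<in> I. poly (X i * conj_reversal n (X j)) z = 0) \<longleftrightarrow>
         (\<forall>k \<in> I. has_root n (X k) (Finite_point z)) \<or>
         (\<forall>k \<in> I. has_root n (X k) (reflect_point (Finite_point z)))"
proof -
  have "poly (conj_reversal n (X j)) z = 0 \<longleftrightarrow> has_root n (X j) (reflect_point (Finite_point z))"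
    if "j \<in> I" for j
    using has_root_conj_reversal_iff[OF X[OF that], of "Finite_point z"] by simp
  then show ?thesis by (auto simp del: reflect_point.simps)
qed

theorem theorem25:
  fixes N K :: nat
    and X :: "nat \<Rightarrow> complex poly"
    and \<Gamma> :: "nat \<Rightarrow> nat \<Rightarrow> complex poly"
    and D :: nat and H :: "complex poly"
  assumes "N \<ge> 1" and "K \<ge> 1"
    and "\<forall>k \<in> {1..K}. X k \<in> polys_le (N - 1)"
    and "\<exists>k \<in> {1..K}. X k \<noteq> 0"
    and "\<forall>i \<in> {1..K}. \<forall>j \<in> {1..K}. \<Gamma> i j = X i * conj_reversal (N - 1) (X j)"
    and "(D, H) = bounded_gcd {(2 * (N - 1), \<Gamma> i j) | i j. i \<in> {1..K} \<and> j \<in> {1..K}}"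
  shows "(essentially_unique_factorization N K \<Gamma> X \<longleftrightarrow>
            \<not> (\<exists>p. p \<notin> unit_circle \<and> (\<forall>k \<in> {1..K}. has_root (N - 1) (X k) p))) \<and>
         (\<not> (\<exists>p. p \<notin> unit_circle \<and> (\<forall>k \<in> {1..K}. has_root (N - 1) (X k) p)) \<longleftrightarrow>
            \<not> (\<exists>z. Finite_point z \<notin> unit_circle \<and> has_root D H (Finite_point z)))"
proof -
  let ?n = "N - 1" and ?I = "{1..K}"
  let ?S = "{(2 * (N - 1), \<Gamma> i j) | i j. i \<in> {1..K} \<and> j \<in> {1..K}}"
  have X: "\<And>k. k \<in> ?I \<Longrightarrow> X k \<in> polys_le ?n" and nz: "\<exists>k \<in> ?I. X k \<noteq> 0"
    and \<Gamma>: "\<And>i j. i \<in> ?I \<Longrightarrow> j \<in> ?I \<Longrightarrow> \<Gamma> i j = X i * conj_reversal ?n (X j)"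
    using assms(3-5) by auto
  have unique: "essentially_unique_factorization N K \<Gamma> X \<longleftrightarrow>
      \<not> (\<exists>p. p \<notin> unit_circle \<and> (\<forall>k \<in> ?I. has_root ?n (X k) p))"
  proof
    assume U: "essentially_unique_factorization N K \<Gamma> X"
    show "\<not> (\<exists>p. p \<notin> unit_circle \<and> (\<forall>k \<in> ?I. has_root ?n (X k) p))"
    proof
      assume "\<exists>p. p \<notin> unit_circle \<and> (\<forall>k \<in> ?I. has_root ?n (X k) p)"
      then obtain p where p: "p \<notin> unit_circle" "\<And>k. k \<in> ?I \<Longrightarrow> has_root ?n (X k) p" by blast
      obtain Y where "\<And>k. k \<in> ?I \<Longrightarrow> Y k \<in> polys_le ?n"
        "\<And>i j. i \<in> ?I \<Longrightarrow> j \<in> ?I \<Longrightarrow> Y i * conj_reversal ?n (Y j) = X i * conj_reversal ?n (X j)"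
        "\<not> (\<exists>\<beta> \<in> sphere 0 1. \<forall>k \<in> ?I. Y k = smult \<beta> (X k))"
        using common_root_imp_other_factorization[of ?I X ?n, OF X nz p] by blast
      with U \<Gamma> show False
        by (simp add: essentially_unique_factorization_def is_factorization_def)
    qed
  next
    assume "\<not> (\<exists>p. p \<notin> unit_circle \<and> (\<forall>k \<in> ?I. has_root ?n (X k) p))"
    then have no_root: "\<And>p. p \<notin> unit_circle \<Longrightarrow> \<exists>k \<in> ?I. \<not> has_root ?n (X k) p" by blast
    show "essentially_unique_factorization N K \<Gamma> X"
      unfolding essentially_unique_factorization_def
    proof (intro allI impI)
      fix Y assume "is_factorization N K \<Gamma> Y"
      then have "\<And>k. k \<in> ?I \<Longrightarrow> Y k \<in> polys_le ?n"
        and "\<And>i j. i \<in> ?I \<Longrightarrow> j \<in> ?I \<Longrightarrow> Y i * conj_reversal ?n (Y j) = X i * conj_reversal ?n (X j)"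
        using \<Gamma> by (simp_all add: is_factorization_def)
      then show "\<exists>\<beta> \<in> sphere 0 1. \<forall>k \<in> ?I. Y k = smult \<beta> (X k)"
        by (intro equal_products_imp_unimodular_multiple[of ?I X ?n Y] X nz no_root)
    qed
  qed
  have "is_bounded_gcd ?S (bounded_gcd ?S)"
  proof (rule bounded_gcd_correct)
    fix M C assume "(M, C) \<in> ?S"
    then obtain i j where ij: "i \<in> ?I" "j \<in> ?I" "M = 2 * ?n" "C = X i * conj_reversal ?n (X j)"
      using \<Gamma> by auto
    then show "C \<in> polys_le M"
      using degree_mult_le[of "X i" "conj_reversal ?n (X j)"] X[of i]
        conj_reversal_in_polys_le[of ?n "X j"]
      by (simp add: polys_le_def)
  qed
  then have gcd: "is_bounded_gcd ?S (D, H)" using assms(6) by simp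
  have \<Gamma>_nz: "\<exists>C \<in> ?S. snd C \<noteq> 0"
  proof -
    obtain k where k: "k \<in> ?I" "X k \<noteq> 0" using nz by blast
    then have "\<Gamma> k k \<noteq> 0" using \<Gamma>[of k k] conj_reversal_eq_0_iff[OF X[of k]] by auto
    then show ?thesis using k(1) by auto
  qed
  have "poly H z = 0 \<longleftrightarrow> (\<forall>i \<in> ?I. \<forall>j \<in> ?I. poly (\<Gamma> i j) z = 0)" for z
    unfolding bounded_gcd_root_iff[OF gcd \<Gamma>_nz] by fastforce
  then have H_root: "poly H z = 0 \<longleftrightarrow> (\<forall>k \<in> ?I. has_root ?n (X k) (Finite_point z)) \<or>
      (\<forall>k \<in> ?I. has_root ?n (X k) (reflect_point (Finite_point z)))" for z
    using products_common_root_iff[of ?I X ?n z, OF X] \<Gamma> by simp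
  have "(\<exists>p. p \<notin> unit_circle \<and> (\<forall>k \<in> ?I. has_root ?n (X k) p)) \<longleftrightarrow>
      (\<exists>z. Finite_point z \<notin> unit_circle \<and> has_root D H (Finite_point z))"
  proof
    assume "\<exists>p. p \<notin> unit_circle \<and> (\<forall>k \<in> ?I. has_root ?n (X k) p)"
    then obtain p where p: "p \<notin> unit_circle" "\<forall>k \<in> ?I. has_root ?n (X k) p" by blast
    show "\<exists>z. Finite_point z \<notin> unit_circle \<and> has_root D H (Finite_point z)"
    proof (cases p)
      case (Finite_point z)
      with p H_root[of z] show ?thesis by auto
    next
      case Infinite_point
      with p have "poly H 0 = 0" by (simp add: H_root)
      then show ?thesis by (intro exI[of _ 0]) (auto simp: unit_circle_def)
    qed
  next
    assume "\<exists>z. Finite_point z \<notin> unit_circle \<and> has_root D H (Finite_point z)"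
    then obtain z where z: "Finite_point z \<notin> unit_circle" "poly H z = 0" by auto
    then have "reflect_point (Finite_point z) \<notin> unit_circle"
      using reflect_point_in_unit_circle_iff by blast
    with z H_root[of z] show "\<exists>p. p \<notin> unit_circle \<and> (\<forall>k \<in> ?I. has_root ?n (X k) p)" by blast
  qed
  with unique show ?thesis by blast
qed

end
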